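(* Let $(\mathbb{N}_0,b,m)$ be a birth-death chain and let $L_c$ be the restriction of its formal Laplacian to the finitely supported functions, viewed as an operator on $\ell^2(\mathbb{N}_0,m)$. Then the following statements are equivalent: (i) $L_c$ is essentially self-adjoint. (ii) $\mathrm{Cap}_{2,2}(\infty)=0$ or $\mathrm{Cap}_{2,2}(\infty)=\infty$.
   Context: A birth-death chain $(\mathbb{N}_0,b,m)$ consists of the vertex set $\mathbb{N}_0=\{0,1,2,\ldots\}$, a symmetric function $b\colon \mathbb{N}_0\times\mathbb{N}_0\to[0,\infty)$ with $b(x,y)>0$ if and only if $|x-y|=1$, and a function $m\colon\mathbb{N}_0\to(0,\infty)$. All functions are real-valued. $\ell^2(\mathbb{N}_0,m)$ is the Hilbert space of functions $f$ with $\|f\|^2=\sum_x f^2(x)m(x)<\infty$, with inner product $\langle f,g\rangle=\sum_x f(x)g(x)m(x)$. The formal Laplacian is $\Delta f(x)=\frac{1}{m(x)}\sum_{y} b(x,y)(f(x)-f(y))$, and $L_c=\Delta|_{C_c(\mathbb{N}_0)}$ where $C_c(\mathbb{N}_0)$ is the set of finitely supported functions. $L_c$ is essentially self-adjoint if it has a unique self-adjoint extension, equivalently if its closure is self-adjoint. The energy of $f$ is $\mathcal{Q}(f)=\frac12\sum_{x,y}b(x,y)(f(x)-f(y))^2\in[0,\infty]$. $H^2(\mathbb{N}_0,m)=\{f\in\ell^2(\mathbb{N}_0,m)\mid \Delta f\in\ell^2(\mathbb{N}_0,m),\ \mathcal{Q}(f)<\infty\}$ with norm $\|f\|_{H^2}^2=\|f\|^2+\|\Delta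 f\|^2+\mathcal{Q}(f)$. For $n\in\mathbb{N}_0$ let $\mathcal{C}_n=\{f\in H^2(\mathbb{N}_0,m)\mid f(r)=1 \text{ for all } r\ge n\}$. The $(2,2)$-capacity at infinity is $$\mathrm{Cap}_{2,2}(\infty)=\begin{cases}\infty & \text{if } \mathcal{C}_n=\emptyset \text{ for some } n\in\mathbb{N}_0,\\ \lim_{n\to\infty}\inf_{f\in\mathcal{C}_n}\|f\|_{H^2}^2 & \text{otherwise.}\end{cases}$$ *)

theory Defs
  imports Complex_Main "HOL-Library.Extended_Nonnegative_Real"
begin

locale birth_death_chain =
  fixes b :: "nat \<Rightarrow> nat \<Rightarrow> real" and m :: "nat \<Rightarrow> real"
  assumes b_sym: "b x y = b y x"
    and b_nonneg: "0 \<le> b x y"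
    and b_pos_iff: "0 < b x y \<longleftrightarrow> \<bar>int x - int y\<bar> = 1"
    and m_pos: "0 < m x"

definition l2 :: "(nat \<Rightarrow> real) \<Rightarrow> (nat \<Rightarrow> real) set" where
  "l2 m = {f. summable (\<lambda>x. (f x)\<^sup>2 * m x)}"

definition l2_inner :: "(nat \<Rightarrow> real) \<Rightarrow> (nat \<Rightarrow> real) \<Rightarrow> (nat \<Rightarrow> real) \<Rightarrow> real" where
  "l2_inner m f g = (\<Sum>x. f x * g x * m x)"

definition l2_norm :: "(nat \<Rightarrow> real) \<Rightarrow> (nat \<Rightarrow> real) \<Rightarrow> real" where
  "l2_norm m f = sqrt (l2_inner m f f)"

text \<open>For a birth-death chain at most two terms of the sum over \<open>y\<close> are nonzero, so the
  formal Laplacian is defined on all functions.\<close>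

definition laplacian :: "(nat \<Rightarrow> nat \<Rightarrow> real) \<Rightarrow> (nat \<Rightarrow> real) \<Rightarrow> (nat \<Rightarrow> real) \<Rightarrow> nat \<Rightarrow> real" where
  "laplacian b m f x = 1 / m x * (\<Sum>y. b x y * (f x - f y))"

definition energy :: "(nat \<Rightarrow> nat \<Rightarrow> real) \<Rightarrow> (nat \<Rightarrow> real) \<Rightarrow> ennreal" where
  "energy b f = (\<Sum>x. \<Sum>y. ennreal (b x y * (f x - f y)\<^sup>2)) / 2"

text \<open>Unbounded operators on \<open>l2 m\<close> are represented by their graphs, so that the domain of
  \<open>T\<close> is \<open>Domain T\<close>, extension of operators is inclusion of graphs, and equality of
  operators (including their domains) is equality of graphs.\<close>

definition l2_operator :: "(nat \<Rightarrow> real) \<Rightarrow> ((nat \<Rightarrow> real) \<times> (nat \<Rightarrow> real)) set \<Rightarrow> bool" where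
  "l2_operator m T \<longleftrightarrow>
     T \<subseteq> l2 m \<times> l2 m \<and> single_valued T \<and> ((\<lambda>_. 0), (\<lambda>_. 0)) \<in> T \<and>
     (\<forall>f g f' g' a. (f, g) \<in> T \<longrightarrow> (f', g') \<in> T \<longrightarrow>
        ((\<lambda>x. a * f x + f' x), (\<lambda>x. a * g x + g' x)) \<in> T)"

definition densely_defined :: "(nat \<Rightarrow> real) \<Rightarrow> ((nat \<Rightarrow> real) \<times> (nat \<Rightarrow> real)) set \<Rightarrow> bool" where
  "densely_defined m T \<longleftrightarrow>
     (\<forall>f\<in>l2 m. \<forall>\<epsilon>>0. \<exists>u\<in>Domain T. l2_norm m (\<lambda>x. f x - u x) < \<epsilon>)"

definition adjoint_graph ::
    "(nat \<Rightarrow> real) \<Rightarrow> ((nat \<Rightarrow> real) \<times> (nat \<Rightarrow> real)) set \<Rightarrow> ((nat \<Rightarrow> real) \<times> (nat \<Rightarrow> real)) set" where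
  "adjoint_graph m T =
     {(f, g) \<in> l2 m \<times> l2 m. \<forall>(u, v)\<in>T. l2_inner m v f = l2_inner m u g}"

definition self_adjoint :: "(nat \<Rightarrow> real) \<Rightarrow> ((nat \<Rightarrow> real) \<times> (nat \<Rightarrow> real)) set \<Rightarrow> bool" where
  "self_adjoint m T \<longleftrightarrow> l2_operator m T \<and> densely_defined m T \<and> adjoint_graph m T = T"

definition essentially_self_adjoint ::
    "(nat \<Rightarrow> real) \<Rightarrow> ((nat \<Rightarrow> real) \<times> (nat \<Rightarrow> real)) set \<Rightarrow> bool" where
  "essentially_self_adjoint m T \<longleftrightarrow> (\<exists>!S. self_adjoint m S \<and> T \<subseteq> S)"

definition Lc :: "(nat \<Rightarrow> nat \<Rightarrow> real) \<Rightarrow> (nat \<Rightarrow> real) \<Rightarrow> ((nat \<Rightarrow> real) \<times> (nat \<Rightarrow> real)) set" where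
  "Lc b m = {(f, laplacian b m f) | f. finite {x. f x \<noteq> 0}}"

definition H2 :: "(nat \<Rightarrow> nat \<Rightarrow> real) \<Rightarrow> (nat \<Rightarrow> real) \<Rightarrow> (nat \<Rightarrow> real) set" where
  "H2 b m = {f. f \<in> l2 m \<and> laplacian b m f \<in> l2 m \<and> energy b f < \<infinity>}"

definition H2_norm_sq :: "(nat \<Rightarrow> nat \<Rightarrow> real) \<Rightarrow> (nat \<Rightarrow> real) \<Rightarrow> (nat \<Rightarrow> real) \<Rightarrow> ennreal" where
  "H2_norm_sq b m f =
     ennreal ((l2_norm m f)\<^sup>2) + ennreal ((l2_norm m (laplacian b m f))\<^sup>2) + energy b f"

definition cap_class :: "(nat \<Rightarrow> nat \<Rightarrow> real) \<Rightarrow> (nat \<Rightarrow> real) \<Rightarrow> nat \<Rightarrow> (nat \<Rightarrow> real) set" where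
  "cap_class b m n = {f \<in> H2 b m. \<forall>r\<ge>n. f r = 1}"

text \<open>The limit exists in the second case, since \<open>cap_class b m n\<close> is increasing in \<open>n\<close> and
  the infima are therefore decreasing.\<close>

definition Cap22_infinity :: "(nat \<Rightarrow> nat \<Rightarrow> real) \<Rightarrow> (nat \<Rightarrow> real) \<Rightarrow> ennreal" where
  "Cap22_infinity b m =
     (if \<exists>n. cap_class b m n = {} then \<infinity>
      else lim (\<lambda>n. INF f\<in>cap_class b m n. H2_norm_sq b m f))"

end

theory Submission
  imports Defs "HOL-Analysis.Convex"
begin

text \<open>Let \<open>r(n) = \<Sum>\<^sub>k\<^sub><\<^sub>n 1 / b(k, k + 1)\<close>, which satisfies \<open>m \<Delta>r = - \<delta>\<^sub>0\<close>. Both statements are equivalent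
  to \<open>r\<close> not being in \<open>\<ell>\<^sup>2\<close>.

  By Green's formula the limit of the Wronskian of \<open>f\<close> and \<open>g\<close> is the defect of symmetry of the
  maximal operator, which is the adjoint of \<open>L\<^sub>c\<close>. If this limit does not vanish for some \<open>f\<close> and
  \<open>g\<close>, then \<open>r\<close> is a combination of \<open>f\<close> and \<open>g\<close> with slowly growing coefficients and hence in
  \<open>\<ell>\<^sup>2\<close>; otherwise the maximal operator is the only self-adjoint extension. If \<open>r\<close> is in \<open>\<ell>\<^sup>2\<close>, so
  are the constants, and the boundary conditions given by \<open>1\<close> and by \<open>r\<close> define two different
  self-adjoint extensions.

  The capacity is infinite if and only if \<open>m\<close> is not summable, and then \<open>r\<close> is not in \<open>\<ell>\<^sup>2\<close>. For
  summable \<open>m\<close>, a function \<open>f\<close> which is eventually \<open>1\<close> satisfies \<open>1 = f(0) + \<langle>\<Delta>f, r\<rangle>\<close>. This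
  bounds the capacity from below if \<open>r\<close> is in \<open>\<ell>\<^sup>2\<close>, and otherwise suggests competitors
  with \<open>\<Delta>f\<close> proportional to a truncation of \<open>r\<close>.\<close>

section \<open>Weighted square summable functions\<close>

lemma summable_l2_mult:
  assumes "f \<in> l2 m" "g \<in> l2 m" "\<And>x. 0 \<le> m x"
  shows "summable (\<lambda>x. f x * g x * m x)"
proof (rule summable_comparison_test')
  show "summable (\<lambda>x. (f x)\<^sup>2 * m x + (g x)\<^sup>2 * m x)"
    using assms by (intro summable_add) (auto simp: l2_def)
  show "norm (f x * g x * m x) \<le> (f x)\<^sup>2 * m x + (g x)\<^sup>2 * m x" if "x \<ge> 0" for x
  proof -
    have "2 * (\<bar>f x\<bar> * \<bar>g x\<bar>) \<le> (f x)\<^sup>2 + (g x)\<^sup>2"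
      using zero_le_power2[of "\<bar>f x\<bar> - \<bar>g x\<bar>"] by (simp add: power2_diff)
    moreover have "0 \<le> \<bar>f x\<bar> * \<bar>g x\<bar>" by simp
    ultimately have "\<bar>f x\<bar> * \<bar>g x\<bar> \<le> (f x)\<^sup>2 + (g x)\<^sup>2" by linarith
    then show ?thesis
      using mult_right_mono[OF _ assms(3)[of x]] assms(3)[of x]
      by (fastforce simp: abs_mult distrib_right)
  qed
qed

lemma l2_lincomb:
  assumes "f \<in> l2 m" "g \<in> l2 m" "\<And>x. 0 \<le> m x"
  shows "(\<lambda>x. a * f x + g x) \<in> l2 m"
proof -
  have "summable (\<lambda>x. a\<^sup>2 * ((f x)\<^sup>2 * m x) + 2 * a * (f x * g x * m x) + (g x)\<^sup>2 * m x)"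
    using assms summable_l2_mult[OF assms]
    by (intro summable_add summable_mult) (auto simp: l2_def)
  then show ?thesis
    by (simp add: l2_def power2_sum algebra_simps power_mult_distrib)
qed

lemma l2_inner_lincomb:
  assumes "f \<in> l2 m" "g \<in> l2 m" "h \<in> l2 m" "\<And>x. 0 \<le> m x"
  shows "l2_inner m (\<lambda>x. a * f x + g x) h = a * l2_inner m f h + l2_inner m g h"
proof -
  have "(\<lambda>x. a * (f x * h x * m x) + g x * h x * m x) sums
      (a * l2_inner m f h + l2_inner m g h)"
    unfolding l2_inner_def using assms
    by (intro sums_add sums_mult summable_sums summable_l2_mult) auto
  then show ?thesis
    unfolding l2_inner_def by (simp add: sums_iff algebra_simps)
qed

lemma l2_inner_commute: "l2_inner m f g = l2_inner m g f"
  by (simp add: l2_inner_def mult.commute)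

lemma finite_support_l2: "finite {x. f x \<noteq> 0} \<Longrightarrow> f \<in> l2 m"
  unfolding l2_def by (auto intro!: summable_finite[of "{x. f x \<noteq> 0}"])

lemma l2_norm_sq:
  assumes "\<And>x. 0 \<le> m x" "f \<in> l2 m"
  shows "(l2_norm m f)\<^sup>2 = (\<Sum>x. (f x)\<^sup>2 * m x)"
proof -
  have "0 \<le> (\<Sum>x. (f x)\<^sup>2 * m x)"
    using assms by (intro suminf_nonneg) (auto simp: l2_def)
  then show ?thesis
    by (simp add: l2_norm_def l2_inner_def power2_eq_square)
qed

lemma finite_support_dense:
  assumes "f \<in> l2 m" "\<And>x. 0 \<le> m x" "0 < e"
  obtains u where "finite {x. u x \<noteq> 0}" "l2_norm m (\<lambda>x. f x - u x) < e"
proof -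
  have s: "summable (\<lambda>x. (f x)\<^sup>2 * m x)" using assms by (simp add: l2_def)
  obtain N where N: "norm (\<Sum>i. (f (i + N))\<^sup>2 * m (i + N)) < e\<^sup>2"
    using suminf_exist_split[OF _ s, of "e\<^sup>2"] assms(3) by auto
  define u where "u x = (if x < N then f x else 0)" for x
  let ?g = "\<lambda>x. (f x - u x) * (f x - u x) * m x"
  have "summable (\<lambda>i. ?g (i + N))"
    using summable_ignore_initial_segment[OF s, of N] by (simp add: u_def power2_eq_square)
  then have "summable ?g" by (rule summable_iff_shift[THEN iffD1])
  from suminf_split_initial_segment[OF this, of N]
  have "suminf ?g = (\<Sum>i. (f (i + N))\<^sup>2 * m (i + N))"
    by (simp add: u_def power2_eq_square)
  then have "l2_inner m (\<lambda>x. f x - u x) (\<lambda>x. f x - u x) < e\<^sup>2"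
    using N by (simp add: l2_inner_def)
  then have "l2_norm m (\<lambda>x. f x - u x) < e"
    using assms(3) by (simp add: l2_norm_def real_less_lsqrt)
  moreover have "finite {x. u x \<noteq> 0}"
    by (rule finite_subset[of _ "{..<N}"]) (auto simp: u_def split: if_splits)
  ultimately show ?thesis by (rule that[rotated])
qed

lemma weighted_Cauchy_Schwarz_sum:
  fixes f g m :: "'a \<Rightarrow> real"
  assumes "\<And>x. 0 \<le> m x"
  shows "(\<Sum>x\<in>A. f x * g x * m x)\<^sup>2 \<le> (\<Sum>x\<in>A. (f x)\<^sup>2 * m x) * (\<Sum>x\<in>A. (g x)\<^sup>2 * m x)"
  using Cauchy_Schwarz_ineq_sum[of "\<lambda>x. f x * sqrt (m x)" "\<lambda>x. g x * sqrt (m x)" A] assms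
  by (simp add: power_mult_distrib mult.assoc mult.left_commute[of "sqrt _"])

lemma sum_le_l2_norm_sq:
  assumes "\<And>x. 0 \<le> m x" "f \<in> l2 m" "finite A"
  shows "(\<Sum>x\<in>A. (f x)\<^sup>2 * m x) \<le> (l2_norm m f)\<^sup>2"
  unfolding l2_norm_sq[OF assms(1,2)]
  using assms by (intro sum_le_suminf) (auto simp: l2_def)

text \<open>Cauchy-Schwarz is applied only to the tail, where \<open>h\<close> has mass below
  \<open>\<epsilon> / 2\<close>; the head is bounded independently of \<open>n\<close>. As
  \<open>u\<close> may lie outside \<open>l2 m\<close>, this says that the pairing of
  \<open>u\<close> with \<open>h\<close> grows more slowly than the norm of
  \<open>u\<close>.\<close>

lemma sum_square_le_tail:
  fixes m :: "nat \<Rightarrow> real"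
  assumes "\<And>x. 0 \<le> m x" "h \<in> l2 m" "0 < \<epsilon>"
  obtains C where "\<And>n. (\<Sum>k\<le>n. u k * h k * m k)\<^sup>2 \<le> C + \<epsilon> * (\<Sum>k\<le>n. (u k)\<^sup>2 * m k)"
proof -
  have s: "summable (\<lambda>x. (h x)\<^sup>2 * m x)" using assms by (simp add: l2_def)
  obtain K where K: "\<And>a b. K \<le> a \<Longrightarrow> norm (\<Sum>x\<in>{a..<b}. (h x)\<^sup>2 * m x) < \<epsilon> / 2"
    using s unfolding summable_Cauchy using assms(3) by (meson half_gt_zero)
  define A where "A = (\<Sum>k<K. \<bar>u k * h k * m k\<bar>)"
  show ?thesis
  proof (rule that[of "2 * A\<^sup>2"])
    fix n
    define p where "p = (\<Sum>k\<in>{..n} \<inter> {..<K}. u k * h k * m k)"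
    define q where "q = (\<Sum>k\<in>{K..n}. u k * h k * m k)"
    have split: "(\<Sum>k\<le>n. u k * h k * m k) = p + q"
      unfolding p_def q_def
      by (subst sum.union_disjoint[symmetric]) (auto intro!: sum.cong)
    have "\<bar>p\<bar> \<le> A"
      unfolding p_def A_def
      by (rule order_trans[OF sum_abs]) (auto intro!: sum_mono2)
    then have p2: "p\<^sup>2 \<le> A\<^sup>2" by (rule abs_le_square_iff[THEN iffD1, OF order_trans]) simp
    have "q\<^sup>2 \<le> (\<Sum>k\<in>{K..n}. (u k)\<^sup>2 * m k) * (\<Sum>k\<in>{K..n}. (h k)\<^sup>2 * m k)"
      unfolding q_def by (rule weighted_Cauchy_Schwarz_sum) (rule assms)
    also have "\<dots> \<le> (\<Sum>k\<le>n. (u k)\<^sup>2 * m k) * (\<epsilon> / 2)"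
    proof (rule mult_mono)
      show "(\<Sum>k\<in>{K..n}. (u k)\<^sup>2 * m k) \<le> (\<Sum>k\<le>n. (u k)\<^sup>2 * m k)"
        using assms by (intro sum_mono2) auto
      show "(\<Sum>k\<in>{K..n}. (h k)\<^sup>2 * m k) \<le> \<epsilon> / 2"
        using K[of K "Suc n"] by (simp add: atLeastLessThanSuc_atLeastAtMost)
    qed (use assms in \<open>auto intro!: sum_nonneg\<close>)
    finally have q2: "q\<^sup>2 \<le> (\<Sum>k\<le>n. (u k)\<^sup>2 * m k) * (\<epsilon> / 2)" .
    have "(p + q)\<^sup>2 \<le> 2 * p\<^sup>2 + 2 * q\<^sup>2"
      using zero_le_power2[of "p - q"] by (simp add: power2_sum power2_diff)
    then show "(\<Sum>k\<le>n. u k * h k * m k)\<^sup>2 \<le> 2 * A\<^sup>2 + \<epsilon> * (\<Sum>k\<le>n. (u k)\<^sup>2 * m k)"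
      unfolding split using p2 q2 by (simp add: mult.commute)
  qed
qed

section \<open>Green's formula\<close>

context birth_death_chain
begin

lemma m_nonneg: "0 \<le> m x"
  using m_pos[of x] by simp

definition edge :: "nat \<Rightarrow> real" where
  "edge n = b n (Suc n)"

lemma edge_pos: "0 < edge n"
  by (simp add: edge_def b_pos_iff)

section \<open>The Laplacian and the energy in terms of edges\<close>

lemma b_eq_0: "y \<noteq> Suc x \<Longrightarrow> x \<noteq> Suc y \<Longrightarrow> b x y = 0"
  using b_nonneg[of x y] b_pos_iff[of x y] by (auto simp: less_le)

lemma b_Suc: "b (Suc x) x = edge x"
  by (simp add: edge_def b_sym)

text \<open>The value type is general so that the lemma serves both the real sum in the Laplacian
  and the \<open>ennreal\<close> sum in the energy.\<close>

lemma suminf_neighbours: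
  fixes F :: "nat \<Rightarrow> 'a :: {comm_monoid_add, t2_space}"
  assumes "\<And>y. b x y = 0 \<Longrightarrow> F y = 0"
  shows "(\<Sum>y. F y) = F (Suc x) + (case x of 0 \<Rightarrow> 0 | Suc k \<Rightarrow> F k)"
proof -
  have "(\<Sum>y. F y) = sum F {y. y = Suc x \<or> x = Suc y}"
  proof (rule suminf_finite)
    show "finite {y. y = Suc x \<or> x = Suc y}"
      by (rule finite_subset[of _ "{..Suc x}"]) auto
  qed (use assms b_eq_0 in blast)
  also have "{y. y = Suc x \<or> x = Suc y} = insert (Suc x) (case x of 0 \<Rightarrow> {} | Suc k \<Rightarrow> {k})"
    by (auto split: nat.splits)
  also have "sum F \<dots> = F (Suc x) + (case x of 0 \<Rightarrow> 0 | Suc k \<Rightarrow> F k)"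
    by (simp split: nat.splits)
  finally show ?thesis .
qed

lemma laplacian_eq:
  "laplacian b m f x = 1 / m x * (edge x * (f x - f (Suc x)) +
     (case x of 0 \<Rightarrow> 0 | Suc k \<Rightarrow> edge k * (f x - f k)))"
  unfolding laplacian_def
  by (subst suminf_neighbours[of x]) (auto simp: b_Suc edge_def[symmetric] split: nat.split)

lemma laplacian_0: "m 0 * laplacian b m f 0 = edge 0 * (f 0 - f 1)"
  using m_pos[of 0] by (simp add: laplacian_eq)

lemma laplacian_Suc:
  "m (Suc x) * laplacian b m f (Suc x) =
    edge (Suc x) * (f (Suc x) - f (Suc (Suc x))) + edge x * (f (Suc x) - f x)"
  using m_pos[of "Suc x"] by (simp add: laplacian_eq)

lemma laplacian_eqI:
  "m x * laplacian b m f x = m x * c \<Longrightarrow> laplacian b m f x = c"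
  using m_pos[of x] by simp

lemma laplacian_lincomb:
  "laplacian b m (\<lambda>x. a * f x + g x) = (\<lambda>x. a * laplacian b m f x + laplacian b m g x)"
proof
  fix x
  show "laplacian b m (\<lambda>x. a * f x + g x) x = a * laplacian b m f x + laplacian b m g x"
    using m_pos[of x] by (cases x) (simp_all add: laplacian_eq field_simps)
qed

lemma laplacian_const: "laplacian b m (\<lambda>_. c) = (\<lambda>_. 0)"
  by (simp add: laplacian_def fun_eq_iff)

text \<open>Every edge is counted once from each endpoint: \<open>?e'\<close> is \<open>?e\<close>
  shifted by one, so the two sums agree and cancel the factor 1/2.\<close>

lemma energy_eq: "energy b f = (\<Sum>x. ennreal (edge x * (f (Suc x) - f x)\<^sup>2))"
proof -
  let ?e = "\<lambda>x. ennreal (edge x * (f (Suc x) - f x)\<^sup>2)"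
  let ?e' = "\<lambda>x. case x of 0 \<Rightarrow> 0 | Suc k \<Rightarrow> ?e k"
  have "(\<Sum>y. ennreal (b x y * (f x - f y)\<^sup>2)) = ?e x + ?e' x" for x
    by (subst suminf_neighbours[of x])
       (auto simp: edge_def b_sym power2_commute split: nat.splits)
  moreover have "(\<Sum>x. ?e x + ?e' x) = (\<Sum>x. ?e x) + (\<Sum>x. ?e' x)"
    by (rule suminf_add[symmetric]) auto
  moreover have "(\<Sum>x. ?e' x) = (\<Sum>x. ?e x)"
    by (subst suminf_offset[of _ 1]) auto
  ultimately show ?thesis
    by (simp add: energy_def mult_2[symmetric] ennreal_mult_divide_eq mult.commute[of 2])
qed

definition wronskian :: "(nat \<Rightarrow> real) \<Rightarrow> (nat \<Rightarrow> real) \<Rightarrow> nat \<Rightarrow> real" where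
  "wronskian f g n = edge n * (f n * g (Suc n) - f (Suc n) * g n)"

text \<open>Summation by parts: the contributions of the edges inside \<open>{..n}\<close> cancel,
  and only the edge leaving this set remains.\<close>

lemma green:
  "(\<Sum>k\<le>n. laplacian b m f k * g k * m k) - (\<Sum>k\<le>n. f k * laplacian b m g k * m k)
    = wronskian f g n"
proof (induction n)
  case 0
  have "laplacian b m f 0 * g 0 * m 0 - f 0 * laplacian b m g 0 * m 0
      = (m 0 * laplacian b m f 0) * g 0 - f 0 * (m 0 * laplacian b m g 0)"
    by (simp add: algebra_simps)
  then show ?case
    by (simp only: laplacian_0) (simp add: wronskian_def algebra_simps)
next
  case (Suc n)
  have "laplacian b m f (Suc n) * g (Suc n) * m (Suc n) - f (Suc n) * laplacian b m g (Suc n) * m (Suc n)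
      = (m (Suc n) * laplacian b m f (Suc n)) * g (Suc n)
        - f (Suc n) * (m (Suc n) * laplacian b m g (Suc n))"
    by (simp add: algebra_simps)
  then show ?case
    using Suc by (simp only: laplacian_Suc) (simp add: wronskian_def algebra_simps)
qed

text \<open>The Pluecker relation between the 2 x 2 minors of four vectors in the plane, here the
  values at \<open>n\<close> and \<open>Suc n\<close>.\<close>

lemma wronskian_plucker:
  "wronskian f g n * wronskian h k n - wronskian f h n * wronskian g k n
    + wronskian f k n * wronskian g h n = 0"
  by (simp add: wronskian_def algebra_simps)

text \<open>The \<open>r\<close> of the overview: the effective resistance between \<open>0\<close>
  and \<open>n\<close> when \<open>edge k\<close> is a conductance.\<close>

definition resist :: "nat \<Rightarrow> real" where
  "resist n = (\<Sum>k<n. 1 / edge k)"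

lemma resist_0 [simp]: "resist 0 = 0"
  by (simp add: resist_def)

lemma resist_Suc: "resist (Suc n) = resist n + 1 / edge n"
  by (simp add: resist_def)

lemma resist_nonneg: "0 \<le> resist n"
  unfolding resist_def using edge_pos by (intro sum_nonneg) (simp add: less_imp_le)

lemma resist_pos: "0 < n \<Longrightarrow> 0 < resist n"
  by (cases n) (use resist_nonneg edge_pos in \<open>auto simp: resist_Suc add_nonneg_pos\<close>)

lemma resist_ge: "0 < n \<Longrightarrow> resist 1 \<le> resist n"
  unfolding resist_def using edge_pos by (intro sum_mono2) (auto simp: less_imp_le)

text \<open>The flow of \<open>resist\<close> through every edge is 1, so inflow and outflow balance
  at every vertex except \<open>0\<close>.\<close>

lemma laplacian_resist: "laplacian b m resist = (\<lambda>x. if x = 0 then - 1 / m 0 else 0)"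
proof
  fix x
  show "laplacian b m resist x = (if x = 0 then - 1 / m 0 else 0)"
  proof (cases x)
    case 0
    then show ?thesis
      using m_pos[of 0] edge_pos[of 0] laplacian_0[of resist]
      by (auto intro!: laplacian_eqI simp: resist_Suc)
  next
    case (Suc k)
    then show ?thesis
      using edge_pos[of k] edge_pos[of "Suc k"] laplacian_Suc[of k resist]
      by (auto intro!: laplacian_eqI simp: resist_Suc algebra_simps)
  qed
qed

lemma wronskian_one_resist: "wronskian (\<lambda>_. 1) resist n = 1"
  using edge_pos[of n] by (simp add: wronskian_def resist_Suc)

lemma wronskian_resist:
  "wronskian f resist n = f 0 + (\<Sum>k\<le>n. laplacian b m f k * resist k * m k)"
proof -
  have "(\<Sum>k\<le>n. f k * laplacian b m resist k * m k)
      = (\<Sum>k\<le>n. if k = 0 then - f 0 else 0)"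
    using m_pos[of 0] by (intro sum.cong) (auto simp: laplacian_resist)
  then show ?thesis
    using green[of f resist n] by simp
qed

section \<open>The maximal operator and its boundary form\<close>

definition maxdom :: "(nat \<Rightarrow> real) set" where
  "maxdom = {f \<in> l2 m. laplacian b m f \<in> l2 m}"

definition boundary_form :: "(nat \<Rightarrow> real) \<Rightarrow> (nat \<Rightarrow> real) \<Rightarrow> real" where
  "boundary_form f g = l2_inner m (laplacian b m f) g - l2_inner m f (laplacian b m g)"

lemma boundary_form_commute: "boundary_form f g = - boundary_form g f"
  by (simp add: boundary_form_def l2_inner_commute)

lemma boundary_form_self: "boundary_form f f = 0"
  by (simp add: boundary_form_def l2_inner_commute)

lemma wronskian_tendsto:
  assumes "f \<in> maxdom" "g \<in> maxdom"
  shows "wronskian f g \<longlonglongrightarrow> boundary_form f g"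
proof -
  have "(\<lambda>n. (\<Sum>k\<le>n. laplacian b m f k * g k * m k) - (\<Sum>k\<le>n. f k * laplacian b m g k * m k))
      \<longlonglongrightarrow> boundary_form f g"
    unfolding boundary_form_def l2_inner_def
    using assms m_nonneg
    by (intro tendsto_diff summable_LIMSEQ' summable_l2_mult) (auto simp: maxdom_def)
  then show ?thesis by (simp add: green)
qed

text \<open>The limit of the pointwise relation. It bounds the rank of the boundary form by
  two.\<close>

lemma boundary_form_plucker:
  assumes "f \<in> maxdom" "g \<in> maxdom" "h \<in> maxdom" "k \<in> maxdom"
  shows "boundary_form f g * boundary_form h k - boundary_form f h * boundary_form g k
    + boundary_form f k * boundary_form g h = 0"
proof -
  have "(\<lambda>n. wronskian f g n * wronskian h k n - wronskian f h n * wronskian g k n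
      + wronskian f k n * wronskian g h n)
    \<longlonglongrightarrow> boundary_form f g * boundary_form h k - boundary_form f h * boundary_form g k
      + boundary_form f k * boundary_form g h"
    using assms by (intro tendsto_intros wronskian_tendsto)
  then show ?thesis
    by (simp add: wronskian_plucker LIMSEQ_const_iff)
qed

lemma boundary_form_lincomb:
  assumes "f \<in> maxdom" "g \<in> maxdom" "h \<in> maxdom"
  shows "boundary_form (\<lambda>x. a * f x + g x) h = a * boundary_form f h + boundary_form g h"
proof -
  have "l2_inner m (laplacian b m (\<lambda>x. a * f x + g x)) h
      = a * l2_inner m (laplacian b m f) h + l2_inner m (laplacian b m g) h"
    using assms m_nonneg by (simp add: laplacian_lincomb maxdom_def l2_inner_lincomb)
  moreover have "l2_inner m (\<lambda>x. a * f x + g x) (laplacian b m h)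
      = a * l2_inner m f (laplacian b m h) + l2_inner m g (laplacian b m h)"
    using assms m_nonneg by (simp add: maxdom_def l2_inner_lincomb)
  ultimately show ?thesis by (simp add: boundary_form_def right_diff_distrib)
qed

lemma maxdom_lincomb:
  "f \<in> maxdom \<Longrightarrow> g \<in> maxdom \<Longrightarrow> (\<lambda>x. a * f x + g x) \<in> maxdom"
  using m_nonneg by (simp add: maxdom_def laplacian_lincomb l2_lincomb)

section \<open>Finitely supported functions and the adjoint of \<open>Lc b m\<close>\<close>

lemma finite_support_bounded:
  fixes f :: "nat \<Rightarrow> real"
  assumes "finite {x. f x \<noteq> 0}"
  obtains N where "\<And>n. N \<le> n \<Longrightarrow> f n = 0"
proof -
  obtain N where "\<forall>x\<in>{x. f x \<noteq> 0}. x < N"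
    using assms by (auto simp: finite_nat_set_iff_bounded)
  then show ?thesis by (intro that[of N]) (auto simp: leD)
qed

lemma laplacian_finite_support:
  assumes "\<And>n. N \<le> n \<Longrightarrow> f n = c"
  shows "finite {x. laplacian b m f x \<noteq> 0}"
proof (rule finite_subset)
  have "laplacian b m f x = 0" if "N < x" for x
    using that by (cases x) (auto simp: laplacian_eq assms)
  then show "{x. laplacian b m f x \<noteq> 0} \<subseteq> {..N}"
    using linorder_not_le by blast
qed simp

lemma finite_support_maxdom:
  assumes "finite {x. f x \<noteq> 0}"
  shows "f \<in> maxdom"
proof -
  obtain N where "\<And>n. N \<le> n \<Longrightarrow> f n = 0" using finite_support_bounded[OF assms] by blast
  then show ?thesis
    unfolding maxdom_def using assms laplacian_finite_support finite_support_l2 by blast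
qed

lemma boundary_form_finite_support:
  assumes "finite {x. u x \<noteq> 0}" "f \<in> maxdom"
  shows "boundary_form u f = 0"
proof -
  obtain N where N: "\<And>n. N \<le> n \<Longrightarrow> u n = 0" using finite_support_bounded[OF assms(1)] by blast
  have "wronskian u f \<longlonglongrightarrow> 0"
    by (rule tendsto_eventually)
       (auto simp: eventually_sequentially wronskian_def N intro!: exI[of _ N])
  then show ?thesis
    using wronskian_tendsto[OF finite_support_maxdom[OF assms(1)] assms(2)] LIMSEQ_unique by blast
qed

lemma l2_inner_laplacian_delta:
  "l2_inner m (laplacian b m (\<lambda>y. if y = x then 1 else 0)) f = laplacian b m f x * m x"
proof -
  let ?d = "\<lambda>y. if y = x then 1 else 0 :: real"
  have d0: "laplacian b m ?d k = 0" if "k > Suc x" for k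
    using that by (auto simp: laplacian_eq split: nat.splits)
  have "l2_inner m (laplacian b m ?d) f = (\<Sum>k\<le>Suc x. laplacian b m ?d k * f k * m k)"
    unfolding l2_inner_def by (rule suminf_finite) (auto simp: d0)
  \<comment> \<open>The indicator of \<open>x\<close> vanishes at \<open>Suc x\<close> and beyond,
    so the Wronskian at \<open>Suc x\<close> is zero.\<close>
  also have "\<dots> = (\<Sum>k\<le>Suc x. ?d k * laplacian b m f k * m k)"
    using green[of ?d f "Suc x"] by (simp add: wronskian_def)
  also have "\<dots> = laplacian b m f x * m x"
    by (simp add: if_distrib[of "\<lambda>c. c * _"] cong: if_cong)
  finally show ?thesis .
qed

text \<open>Testing against the indicator of each vertex shows that the adjoint acts as the formal
  Laplacian.\<close>

lemma adjoint_Lc_subset: "adjoint_graph m (Lc b m) \<subseteq> {(f, laplacian b m f) | f. f \<in> maxdom}"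
proof (clarsimp simp: adjoint_graph_def)
  fix f g
  assume fg: "f \<in> l2 m" "g \<in> l2 m" "\<forall>(u, v)\<in>Lc b m. l2_inner m v f = l2_inner m u g"
  have "laplacian b m f x = g x" for x
  proof -
    let ?d = "\<lambda>y. if y = x then 1 else 0 :: real"
    have "(?d, laplacian b m ?d) \<in> Lc b m" by (auto simp: Lc_def)
    with fg(3) have "l2_inner m (laplacian b m ?d) f = l2_inner m ?d g" by blast
    moreover have "l2_inner m ?d g = g x * m x"
      unfolding l2_inner_def by (subst suminf_finite[of "{x}"]) auto
    ultimately show ?thesis
      using m_pos[of x] by (simp add: l2_inner_laplacian_delta)
  qed
  then have "g = laplacian b m f" by auto
  then show "g = laplacian b m f \<and> f \<in> maxdom" using fg by (auto simp: maxdom_def)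
qed

section \<open>Self-adjoint extensions\<close>

lemma adjoint_graph_antimono: "S \<subseteq> T \<Longrightarrow> adjoint_graph m T \<subseteq> adjoint_graph m S"
  by (auto simp: adjoint_graph_def)

text \<open>Since \<open>P\<close> contains the finitely supported functions, the adjoint of the
  restriction is again given by the formal Laplacian. Membership in the adjoint is thus a condition
  on the boundary form, and self-adjointness means that \<open>P\<close> equals its own orthogonal
  complement for this form.\<close>

lemma self_adjoint_restriction:
  assumes sub: "P \<subseteq> maxdom" and fin: "\<And>f. finite {x. f x \<noteq> 0} \<Longrightarrow> f \<in> P"
    and lin: "\<And>f g a. f \<in> P \<Longrightarrow> g \<in> P \<Longrightarrow> (\<lambda>x. a * f x + g x) \<in> P"
    and sym: "\<And>f g. f \<in> P \<Longrightarrow> g \<in> P \<Longrightarrow> boundary_form f g = 0"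
    and max: "\<And>f. f \<in> maxdom \<Longrightarrow> (\<And>u. u \<in> P \<Longrightarrow> boundary_form u f = 0) \<Longrightarrow> f \<in> P"
  shows "self_adjoint m {(f, laplacian b m f) | f. f \<in> P}" (is "self_adjoint m ?T")
  unfolding self_adjoint_def
proof (intro conjI)
  show "l2_operator m ?T"
    unfolding l2_operator_def
  proof (intro conjI allI impI)
    show "?T \<subseteq> l2 m \<times> l2 m" using sub by (auto simp: maxdom_def)
    show "single_valued ?T" by (auto simp: single_valued_def)
    show "((\<lambda>_. 0), (\<lambda>_. 0)) \<in> ?T" using fin[of "\<lambda>_. 0"] by (auto simp: laplacian_const)
    show "((\<lambda>x. a * f x + f' x), (\<lambda>x. a * g x + g' x)) \<in> ?T"
      if "(f, g) \<in> ?T" "(f', g') \<in> ?T" for f g f' g' a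
      using that lin by (auto simp: laplacian_lincomb)
  qed
  show "densely_defined m ?T"
    unfolding densely_defined_def
  proof (intro ballI allI impI)
    fix f and e :: real assume "f \<in> l2 m" "0 < e"
    then obtain u where "finite {x. u x \<noteq> 0}" "l2_norm m (\<lambda>x. f x - u x) < e"
      using finite_support_dense m_nonneg by blast
    then show "\<exists>u\<in>Domain ?T. l2_norm m (\<lambda>x. f x - u x) < e"
      using fin by blast
  qed
  show "adjoint_graph m ?T = ?T"
  proof
    have "Lc b m \<subseteq> ?T" using fin by (auto simp: Lc_def)
    then have *: "adjoint_graph m ?T \<subseteq> {(f, laplacian b m f) | f. f \<in> maxdom}"
      using adjoint_graph_antimono adjoint_Lc_subset by blast
    show "adjoint_graph m ?T \<subseteq> ?T"
    proof
      fix p assume p: "p \<in> adjoint_graph m ?T"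
      then obtain f where f: "p = (f, laplacian b m f)" "f \<in> maxdom" using * by blast
      have "boundary_form u f = 0" if "u \<in> P" for u
        using p that by (auto simp: f adjoint_graph_def boundary_form_def)
      then show "p \<in> ?T" using max f by blast
    qed
    show "?T \<subseteq> adjoint_graph m ?T"
      using sub sym by (auto simp: adjoint_graph_def maxdom_def boundary_form_def)
  qed
qed

text \<open>The maximal operator \<open>?T\<close> is self-adjoint. Any other self-adjoint extension
  \<open>S\<close> lies in the adjoint of \<open>Lc b m\<close>, hence in \<open>?T\<close>, and
  taking adjoints reverses this inclusion.\<close>

lemma essentially_self_adjoint_if_boundary_form_0:
  assumes 0: "\<And>f g. f \<in> maxdom \<Longrightarrow> g \<in> maxdom \<Longrightarrow> boundary_form f g = 0"
  shows "essentially_self_adjoint m (Lc b m)"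
  unfolding essentially_self_adjoint_def
proof (rule ex1I)
  let ?T = "{(f, laplacian b m f) | f. f \<in> maxdom}"
  have sa: "self_adjoint m ?T"
    by (rule self_adjoint_restriction) (auto simp: 0 finite_support_maxdom maxdom_lincomb)
  then show "self_adjoint m ?T \<and> Lc b m \<subseteq> ?T"
    using finite_support_maxdom by (auto simp: Lc_def)
  fix S assume S: "self_adjoint m S \<and> Lc b m \<subseteq> S"
  then have "S \<subseteq> ?T"
    using adjoint_graph_antimono[of "Lc b m" S] adjoint_Lc_subset by (auto simp: self_adjoint_def)
  moreover from this have "?T \<subseteq> S"
    using adjoint_graph_antimono[of S ?T] S sa by (simp add: self_adjoint_def)
  ultimately show "S = ?T" by blast
qed

text \<open>The boundary condition given by \<open>u\<close> cuts the symplectic boundary space, which is spanned by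
  \<open>u\<close> and \<open>v\<close>, down to a Lagrangian line.\<close>

lemma self_adjoint_boundary_condition:
  assumes uv: "u \<in> maxdom" "v \<in> maxdom" "boundary_form u v \<noteq> 0"
  shows "self_adjoint m {(f, laplacian b m f) | f. f \<in> maxdom \<and> boundary_form f u = 0}"
proof -
  let ?P = "{f \<in> maxdom. boundary_form f u = 0}"
  have "self_adjoint m {(f, laplacian b m f) | f. f \<in> ?P}"
  proof (rule self_adjoint_restriction)
    show "f \<in> ?P" if "finite {x. f x \<noteq> 0}" for f
      using that uv boundary_form_finite_support finite_support_maxdom by auto
    show "(\<lambda>x. a * f x + g x) \<in> ?P" if "f \<in> ?P" "g \<in> ?P" for f g a
      using that uv maxdom_lincomb by (simp add: boundary_form_lincomb)
    \<comment> \<open>In the Pluecker relation for \<open>f\<close>, \<open>g\<close>,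
      \<open>u\<close>, \<open>v\<close> both other products contain a vanishing factor, and
      \<open>boundary_form u v\<close> can be cancelled.\<close>
    show "boundary_form f g = 0" if "f \<in> ?P" "g \<in> ?P" for f g
      using boundary_form_plucker[of f g u v] that uv by simp
    \<comment> \<open>Here \<open>w = u\<close> suffices, as \<open>u\<close> satisfies its own
      boundary condition.\<close>
    show "f \<in> ?P" if "f \<in> maxdom" and "\<And>w. w \<in> ?P \<Longrightarrow> boundary_form w f = 0" for f
      using that uv boundary_form_self[of u] boundary_form_commute[of f u] by simp
  qed auto
  then show ?thesis by simp
qed

text \<open>The boundary conditions given by \<open>u\<close> and \<open>v\<close> define different
  extensions: \<open>u\<close> satisfies the first but not the second.\<close>

lemma not_essentially_self_adjoint:
  assumes uv: "u \<in> maxdom" "v \<in> maxdom" "boundary_form u v \<noteq> 0"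
  shows "\<not> essentially_self_adjoint m (Lc b m)"
proof
  assume "essentially_self_adjoint m (Lc b m)"
  then have uniq: "S = T" if "self_adjoint m S" "Lc b m \<subseteq> S" "self_adjoint m T" "Lc b m \<subseteq> T" for S T
    using that unfolding essentially_self_adjoint_def by blast
  let ?T = "\<lambda>u. {(f, laplacian b m f) | f. f \<in> maxdom \<and> boundary_form f u = 0}"
  have ext: "Lc b m \<subseteq> ?T w" if "w \<in> maxdom" for w
    using that finite_support_maxdom boundary_form_finite_support by (auto simp: Lc_def)
  have "boundary_form v u \<noteq> 0" using uv boundary_form_commute[of u v] by simp
  then have "?T u = ?T v"
    using uv ext by (intro uniq self_adjoint_boundary_condition) auto
  moreover have "(u, laplacian b m u) \<in> ?T u" using uv boundary_form_self by simp
  ultimately show False using uv by auto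
qed

section \<open>The limit point and limit circle cases\<close>

lemma laplacian_resist_l2: "laplacian b m resist \<in> l2 m"
  by (rule finite_support_l2) (auto simp: laplacian_resist)

lemma summable_m_if_resist_l2:
  assumes "resist \<in> l2 m"
  shows "summable m"
\<comment> \<open>The comparison starts at 1 because \<open>resist 0 = 0\<close>; from there on
  \<open>resist\<close> is at least \<open>resist 1 > 0\<close>.\<close>
proof (rule summable_comparison_test'[where N = 1])
  have r1: "0 < resist 1" by (rule resist_pos) simp
  show "summable (\<lambda>x. ((resist x)\<^sup>2 * m x) / (resist 1)\<^sup>2)"
    using assms by (intro summable_divide) (simp add: l2_def)
  fix n :: nat assume "1 \<le> n"
  then have "(resist 1)\<^sup>2 \<le> (resist n)\<^sup>2"
    using resist_ge[of n] r1 by (intro power_mono) auto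
  then have "(resist 1)\<^sup>2 * m n \<le> (resist n)\<^sup>2 * m n"
    by (rule mult_right_mono) (rule m_nonneg)
  then show "norm (m n) \<le> ((resist n)\<^sup>2 * m n) / (resist 1)\<^sup>2"
    using r1 m_nonneg[of n] by (simp add: field_simps)
qed

lemma not_essentially_self_adjoint_if_resist_l2:
  assumes "resist \<in> l2 m"
  shows "\<not> essentially_self_adjoint m (Lc b m)"
proof (rule not_essentially_self_adjoint)
  show 1: "(\<lambda>_. 1) \<in> maxdom"
    using summable_m_if_resist_l2[OF assms] by (simp add: maxdom_def l2_def laplacian_const)
  show r: "resist \<in> maxdom"
    using assms laplacian_resist_l2 by (simp add: maxdom_def)
  have "wronskian (\<lambda>_. 1) resist \<longlonglongrightarrow> 1"
    by (simp add: wronskian_one_resist[abs_def])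
  then have "boundary_form (\<lambda>_. 1) resist = 1"
    using wronskian_tendsto[OF 1 r] LIMSEQ_unique by blast
  then show "boundary_form (\<lambda>_. 1) resist \<noteq> 0" by simp
qed

text \<open>By \<open>wronskian_resist\<close> the Wronskian is \<open>g 0\<close> plus the pairing
  of \<open>resist\<close> with the Laplacian of \<open>g\<close>, to which
  \<open>sum_square_le_tail\<close> applies even if \<open>resist\<close> is not in
  \<open>l2 m\<close>.\<close>

lemma wronskian_resist_bound:
  assumes "g \<in> maxdom" "0 < \<epsilon>"
  obtains C where "0 \<le> C"
    "\<And>n. (wronskian g resist n)\<^sup>2 \<le> C + \<epsilon> * (\<Sum>k\<le>n. (resist k)\<^sup>2 * m k)"
proof -
  obtain C where C: "\<And>n. (\<Sum>k\<le>n. resist k * laplacian b m g k * m k)\<^sup>2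
      \<le> C + \<epsilon> / 2 * (\<Sum>k\<le>n. (resist k)\<^sup>2 * m k)"
    using sum_square_le_tail[of m "laplacian b m g" "\<epsilon> / 2" resist] assms m_nonneg
    by (auto simp: maxdom_def)
  \<comment> \<open>At \<open>n = 0\<close> both sums vanish since
    \<open>resist 0 = 0\<close>.\<close>
  have C0: "0 \<le> C"
    using C[of 0] by simp
  show ?thesis
  proof (rule that[of "2 * (g 0)\<^sup>2 + 2 * C"])
    fix n
    let ?s = "\<Sum>k\<le>n. resist k * laplacian b m g k * m k"
    have "wronskian g resist n = g 0 + ?s"
      by (simp add: wronskian_resist mult.commute mult.left_commute)
    moreover have "(g 0 + ?s)\<^sup>2 \<le> 2 * (g 0)\<^sup>2 + 2 * ?s\<^sup>2"
      using zero_le_power2[of "g 0 - ?s"] by (simp add: power2_sum power2_diff)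
    ultimately show "(wronskian g resist n)\<^sup>2
        \<le> 2 * (g 0)\<^sup>2 + 2 * C + \<epsilon> * (\<Sum>k\<le>n. (resist k)\<^sup>2 * m k)"
      using C[of n] by simp
  qed (use C0 in auto)
qed

text \<open>If the boundary form does not vanish, the identity
  \<open>r W(f, g) = g W(f, r) - f W(g, r)\<close> estimates \<open>r\<close> by \<open>f\<close> and \<open>g\<close>, up to a factor
  which is absorbed by the left-hand side since it is \<open>o(\<Sum>\<^sub>k\<^sub>\<le>\<^sub>n r(k)\<^sup>2 m(k))\<close>.\<close>

lemma resist_l2_if_boundary_form:
  assumes fg: "f \<in> maxdom" "g \<in> maxdom" and nz: "boundary_form f g \<noteq> 0"
  shows "resist \<in> l2 m"
proof -
  define w where "w = (boundary_form f g)\<^sup>2 / 4"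
  have w: "0 < w" using nz by (simp add: w_def)
  define F where "F = (\<Sum>x. (f x)\<^sup>2 * m x + (g x)\<^sup>2 * m x)"
  have sF: "summable (\<lambda>x. (f x)\<^sup>2 * m x + (g x)\<^sup>2 * m x)"
    using fg by (intro summable_add) (auto simp: maxdom_def l2_def)
  have F: "(\<Sum>x\<in>A. (f x)\<^sup>2 * m x + (g x)\<^sup>2 * m x) \<le> F" if "finite A" for A
    unfolding F_def using that sF m_nonneg by (intro sum_le_suminf) auto
  have F0: "0 \<le> F" using F[of "{}"] by simp
  define s where "s n = (\<Sum>k\<le>n. (resist k)\<^sup>2 * m k)" for n
  have s_mono: "s n \<le> s n'" if "n \<le> n'" for n n'
    unfolding s_def using that m_nonneg by (intro sum_mono2) auto
  have s0: "0 \<le> s n" for n unfolding s_def using m_nonneg by (intro sum_nonneg) auto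
  \<comment> \<open>Chosen so that the term containing \<open>s N\<close> in the final estimate has
    coefficient at most \<open>w / 2\<close>; the summand 1 avoids division by zero.\<close>
  define \<epsilon> where "\<epsilon> = w / (4 * (F + 1))"
  have eps: "0 < \<epsilon>" "2 * \<epsilon> * F \<le> w / 2"
    using w F0 by (auto simp: \<epsilon>_def field_simps)
  obtain C1 where C1: "0 \<le> C1" "\<And>n. (wronskian f resist n)\<^sup>2 \<le> C1 + \<epsilon> * s n"
    using wronskian_resist_bound[OF fg(1) eps(1)] unfolding s_def by metis
  obtain C2 where C2: "0 \<le> C2" "\<And>n. (wronskian g resist n)\<^sup>2 \<le> C2 + \<epsilon> * s n"
    using wronskian_resist_bound[OF fg(2) eps(1)] unfolding s_def by metis
  define C where "C = C1 + C2"
  have "(\<lambda>n. (wronskian f g n)\<^sup>2) \<longlonglongrightarrow> (boundary_form f g)\<^sup>2"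
    using wronskian_tendsto[OF fg] by (intro tendsto_power)
  moreover have "w < (boundary_form f g)\<^sup>2" using w by (simp add: w_def)
  ultimately have "\<forall>\<^sub>F n in sequentially. w < (wronskian f g n)\<^sup>2"
    by (rule order_tendstoD(1))
  then obtain K where K: "\<And>n. K \<le> n \<Longrightarrow> w < (wronskian f g n)\<^sup>2"
    by (auto simp: eventually_sequentially)
  \<comment> \<open>The Wronskians at \<open>n\<close> are bounded in terms of \<open>s N\<close>
    rather than \<open>s n\<close>, so the factor is constant when summing over
    \<open>n\<close>.\<close>
  have pt: "w * ((resist n)\<^sup>2 * m n)
      \<le> 2 * (C + \<epsilon> * s N) * ((f n)\<^sup>2 * m n + (g n)\<^sup>2 * m n)" if "K \<le> n" "n \<le> N" for n N
  proof -
    have "resist n * wronskian f g n = g n * wronskian f resist n - f n * wronskian g resist n"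
      by (simp add: wronskian_def algebra_simps)
    then have "(resist n)\<^sup>2 * (wronskian f g n)\<^sup>2
        = (g n * wronskian f resist n - f n * wronskian g resist n)\<^sup>2"
      by (simp add: power_mult_distrib[symmetric])
    also have "\<dots> \<le> 2 * (g n * wronskian f resist n)\<^sup>2 + 2 * (f n * wronskian g resist n)\<^sup>2"
      using zero_le_power2[of "g n * wronskian f resist n + f n * wronskian g resist n"]
      by (simp add: power2_sum power2_diff)
    also have "\<dots> = 2 * ((g n)\<^sup>2 * (wronskian f resist n)\<^sup>2 + (f n)\<^sup>2 * (wronskian g resist n)\<^sup>2)"
      by (simp add: power_mult_distrib)
    also have "\<dots> \<le> 2 * ((g n)\<^sup>2 * (C + \<epsilon> * s N) + (f n)\<^sup>2 * (C + \<epsilon> * s N))"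
    proof -
      have "\<epsilon> * s n \<le> \<epsilon> * s N" using eps s_mono[OF that(2)] by simp
      then have "(wronskian f resist n)\<^sup>2 \<le> C + \<epsilon> * s N" "(wronskian g resist n)\<^sup>2 \<le> C + \<epsilon> * s N"
        using C1(1) C1(2)[of n] C2(1) C2(2)[of n] unfolding C_def by linarith+
      then show ?thesis by (intro mult_left_mono add_mono) auto
    qed
    finally have *: "(resist n)\<^sup>2 * (wronskian f g n)\<^sup>2
        \<le> 2 * ((g n)\<^sup>2 * (C + \<epsilon> * s N) + (f n)\<^sup>2 * (C + \<epsilon> * s N))" .
    have "(resist n)\<^sup>2 * w \<le> (resist n)\<^sup>2 * (wronskian f g n)\<^sup>2"
      using K[OF that(1)] by (intro mult_left_mono) auto
    from mult_right_mono[OF order_trans[OF this *] m_nonneg[of n]]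
    show ?thesis by (simp add: algebra_simps)
  qed
  have bound: "s N \<le> 2 * (s K + 2 * C * F / w)" for N
  proof (cases "K \<le> N")
    case True
    have "w * (\<Sum>k\<in>{K<..N}. (resist k)\<^sup>2 * m k)
        \<le> (\<Sum>k\<in>{K<..N}. 2 * (C + \<epsilon> * s N) * ((f k)\<^sup>2 * m k + (g k)\<^sup>2 * m k))"
      unfolding sum_distrib_left by (rule sum_mono) (use pt in auto)
    also have "\<dots> = 2 * (C + \<epsilon> * s N) * (\<Sum>k\<in>{K<..N}. (f k)\<^sup>2 * m k + (g k)\<^sup>2 * m k)"
      by (simp add: sum_distrib_left)
    also have "\<dots> \<le> 2 * (C + \<epsilon> * s N) * F"
      using F C1 C2 eps s0[of N] by (intro mult_left_mono) (auto simp: C_def)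
    also have "\<dots> = 2 * C * F + (2 * \<epsilon> * F) * s N" by (simp add: algebra_simps)
    also have "\<dots> \<le> 2 * C * F + (w / 2) * s N"
      using eps s0[of N] by (intro add_left_mono mult_right_mono) auto
    finally have "w * (\<Sum>k\<in>{K<..N}. (resist k)\<^sup>2 * m k) \<le> 2 * C * F + (w / 2) * s N" .
    moreover have "s N = s K + (\<Sum>k\<in>{K<..N}. (resist k)\<^sup>2 * m k)"
      unfolding s_def using True
      by (subst sum.union_disjoint[symmetric]) (auto intro!: sum.cong)
    ultimately have "w * (s N - s K) \<le> 2 * C * F + (w / 2) * s N" by simp
    \<comment> \<open>The term \<open>(w / 2) * s N\<close> is absorbed by the left-hand
      side.\<close>
    then have "w * s N \<le> w * (2 * (s K + 2 * C * F / w))"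
      using w by (simp add: algebra_simps)
    then show ?thesis using w by simp
  next
    case False
    then have "s N \<le> s K" by (intro s_mono) simp
    moreover have "0 \<le> 2 * C * F / w" using w F0 C1 C2 by (simp add: C_def)
    ultimately have "s N \<le> s K + 2 * C * F / w" "0 \<le> s K + 2 * C * F / w"
      using s0[of K] by linarith+
    then show ?thesis by (metis add_increasing mult_2)
  qed
  have "(\<Sum>k<n. (resist k)\<^sup>2 * m k) \<le> 2 * (s K + 2 * C * F / w)" for n
  proof -
    have "(\<Sum>k<n. (resist k)\<^sup>2 * m k) \<le> s n"
      unfolding s_def using m_nonneg by (intro sum_mono2) auto
    then show ?thesis using bound[of n] by linarith
  qed
  then have "summable (\<lambda>x. (resist x)\<^sup>2 * m x)"
    using m_nonneg by (intro summableI_nonneg_bounded[where x = "2 * (s K + 2 * C * F / w)"]) auto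
  then show ?thesis by (simp add: l2_def)
qed

theorem essentially_self_adjoint_iff:
  "essentially_self_adjoint m (Lc b m) \<longleftrightarrow> resist \<notin> l2 m"
proof
  show "resist \<notin> l2 m" if "essentially_self_adjoint m (Lc b m)"
    using that not_essentially_self_adjoint_if_resist_l2 by metis
  show "essentially_self_adjoint m (Lc b m)" if "resist \<notin> l2 m"
  proof (rule essentially_self_adjoint_if_boundary_form_0)
    fix f g assume "f \<in> maxdom" "g \<in> maxdom"
    from resist_l2_if_boundary_form[OF this] that show "boundary_form f g = 0" by auto
  qed
qed

section \<open>The capacity at infinity\<close>

lemma summable_m_if_cap_class:
  assumes "f \<in> cap_class b m n"
  shows "summable m"
proof (rule summable_comparison_test'[where N = n])
  show "summable (\<lambda>x. (f x)\<^sup>2 * m x)"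
    using assms by (simp add: cap_class_def H2_def l2_def)
  show "norm (m x) \<le> (f x)\<^sup>2 * m x" if "n \<le> x" for x
    using assms that m_nonneg[of x] by (simp add: cap_class_def)
qed

lemma energy_const: "energy b (\<lambda>_. c) = 0"
  by (simp add: energy_eq)

lemma one_in_cap_class: "summable m \<Longrightarrow> (\<lambda>_. 1) \<in> cap_class b m n"
  by (simp add: cap_class_def H2_def laplacian_const energy_const l2_def)

lemma H2_norm_sq_finite: "f \<in> H2 b m \<Longrightarrow> H2_norm_sq b m f < \<infinity>"
  by (simp add: H2_norm_sq_def H2_def)

lemma cap_class_mono: "n \<le> n' \<Longrightarrow> cap_class b m n \<subseteq> cap_class b m n'"
  by (auto simp: cap_class_def)

text \<open>The classes increase with \<open>n\<close> and contain the constant 1, so the capacity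
  is the limit of decreasing infima.\<close>

lemma Cap22_infinity_eq_INF:
  assumes "summable m"
  shows "Cap22_infinity b m = (INF n. INF f\<in>cap_class b m n. H2_norm_sq b m f)"
proof -
  have "decseq (\<lambda>n. INF f\<in>cap_class b m n. H2_norm_sq b m f)"
    unfolding decseq_def
    by (intro allI impI, rule INF_superset_mono[OF cap_class_mono order_refl])
  then have "(\<lambda>n. INF f\<in>cap_class b m n. H2_norm_sq b m f)
      \<longlonglongrightarrow> (INF n. INF f\<in>cap_class b m n. H2_norm_sq b m f)"
    by (rule LIMSEQ_INF)
  moreover have "\<not> (\<exists>n. cap_class b m n = {})"
    using one_in_cap_class[OF assms] by blast
  ultimately show ?thesis
    by (simp add: Cap22_infinity_def limI)
qed

text \<open>A member of a class is 1 near infinity, which forces \<open>m\<close> to be summable;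
  conversely, the norm of the constant 1 bounds the capacity.\<close>

lemma Cap22_infinity_eq_top_iff: "Cap22_infinity b m = \<infinity> \<longleftrightarrow> \<not> summable m"
proof
  assume "\<not> summable m"
  then have "cap_class b m 0 = {}" using summable_m_if_cap_class by blast
  then show "Cap22_infinity b m = \<infinity>" by (auto simp: Cap22_infinity_def)
next
  assume top: "Cap22_infinity b m = \<infinity>"
  show "\<not> summable m"
  proof
    assume s: "summable m"
    have "Cap22_infinity b m \<le> H2_norm_sq b m (\<lambda>_. 1)"
      unfolding Cap22_infinity_eq_INF[OF s]
      using one_in_cap_class[OF s] by (intro INF_lower2[of 0] INF_lower) auto
    also have "\<dots> < \<infinity>"
      using one_in_cap_class[OF s, of 0] by (intro H2_norm_sq_finite) (simp add: cap_class_def)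
    finally show False using top by simp
  qed
qed

text \<open>Green's formula, applied to \<open>f\<close> and \<open>r\<close>, reads \<open>1 = f(0) + \<langle>\<Delta>f, r\<rangle>\<close>.\<close>

lemma cap_class_norm_ge:
  assumes f: "f \<in> cap_class b m n" and r: "resist \<in> l2 m"
  shows "1 \<le> (2 / m 0 + 2 * (l2_norm m resist)\<^sup>2)
    * ((l2_norm m f)\<^sup>2 + (l2_norm m (laplacian b m f))\<^sup>2)"
proof -
  let ?s = "\<Sum>k\<le>n. laplacian b m f k * resist k * m k"
  let ?a = "(l2_norm m f)\<^sup>2" and ?l = "(l2_norm m (laplacian b m f))\<^sup>2"
    and ?r = "(l2_norm m resist)\<^sup>2"
  have l2: "f \<in> l2 m" "laplacian b m f \<in> l2 m" and f1: "\<And>k. n \<le> k \<Longrightarrow> f k = 1"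
    using f by (auto simp: cap_class_def H2_def)
  \<comment> \<open>Since \<open>f\<close> is 1 at \<open>n\<close> and \<open>Suc n\<close>, only
    the unit flow of \<open>resist\<close> remains.\<close>
  have "wronskian f resist n = 1"
    using edge_pos[of n] by (simp add: wronskian_def f1 resist_Suc)
  then have "1 = f 0 + ?s" by (simp add: wronskian_resist)
  then have "1 = (f 0 + ?s)\<^sup>2" by simp
  also have "\<dots> \<le> 2 * (f 0)\<^sup>2 + 2 * ?s\<^sup>2"
    using zero_le_power2[of "f 0 - ?s"] by (simp add: power2_sum power2_diff)
  also have "(f 0)\<^sup>2 \<le> ?a / m 0"
    using sum_le_l2_norm_sq[of m f "{0}"] l2 m_nonneg m_pos[of 0] by (simp add: pos_le_divide_eq)
  also have "?s\<^sup>2 \<le> ?l * ?r"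
  proof -
    have "?s\<^sup>2 \<le> (\<Sum>k\<le>n. (laplacian b m f k)\<^sup>2 * m k) * (\<Sum>k\<le>n. (resist k)\<^sup>2 * m k)"
      by (rule weighted_Cauchy_Schwarz_sum) (rule m_nonneg)
    also have "\<dots> \<le> ?l * ?r"
      using l2 r m_nonneg by (intro mult_mono sum_le_l2_norm_sq sum_nonneg) auto
    finally show ?thesis .
  qed
  finally have "1 \<le> 2 * (?a / m 0) + 2 * (?l * ?r)" by simp
  also have "\<dots> \<le> (2 / m 0 + 2 * ?r) * (?a + ?l)"
    using m_pos[of 0] by (simp add: algebra_simps)
  finally show ?thesis .
qed

text \<open>The bound of \<open>cap_class_norm_ge\<close> depends on neither \<open>f\<close> nor
  \<open>n\<close>, and the energy only enlarges the norm.\<close>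

lemma Cap22_infinity_pos:
  assumes r: "resist \<in> l2 m"
  shows "Cap22_infinity b m \<noteq> 0"
proof -
  define c where "c = 2 / m 0 + 2 * (l2_norm m resist)\<^sup>2"
  have c: "0 < c" using m_pos[of 0] by (simp add: c_def add_pos_nonneg)
  have "ennreal (1 / c) \<le> H2_norm_sq b m f" if "f \<in> cap_class b m n" for f n
  proof -
    have "1 / c \<le> (l2_norm m f)\<^sup>2 + (l2_norm m (laplacian b m f))\<^sup>2"
      using cap_class_norm_ge[OF that r] c by (simp add: c_def[symmetric] field_simps)
    then have "ennreal (1 / c) \<le> ennreal ((l2_norm m f)\<^sup>2) + ennreal ((l2_norm m (laplacian b m f))\<^sup>2)"
      by (simp flip: ennreal_plus add: ennreal_leI)
    then show ?thesis
      unfolding H2_norm_sq_def by (rule order_trans) simp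
  qed
  then have "ennreal (1 / c) \<le> Cap22_infinity b m"
    unfolding Cap22_infinity_eq_INF[OF summable_m_if_resist_l2[OF r]]
    by (intro INF_greatest) auto
  then show ?thesis using c by (auto simp: ennreal_le_iff2)
qed

text \<open>The competitor \<open>f\<close> is the solution of \<open>f(0) = 0\<close> and \<open>\<Delta>f = r / S\<close> on \<open>{1..N}\<close>, where
  \<open>S = \<Sum>\<^sub>k\<^sub>\<le>\<^sub>N r(k)\<^sup>2 m(k)\<close>, with \<open>\<Delta>f(0)\<close> chosen such that \<open>\<langle>\<Delta>f, 1\<rangle> = 0\<close>; it becomes constant
  after \<open>N\<close>, and \<open>f(N) = \<langle>\<Delta>f, r\<rangle> = 1\<close>. Below, \<open>p n\<close> is the flow through the edge from \<open>n\<close> to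
  \<open>Suc n\<close>.\<close>

lemma cap_class_competitor:
  fixes N K :: nat
  defines "S \<equiv> (\<Sum>k\<le>N. (resist k)\<^sup>2 * m k)"
  assumes sm: "summable m" and S: "0 < S"
  obtains f where "f \<in> cap_class b m N"
    "H2_norm_sq b m f \<le> ennreal (suminf m * (\<Sum>k<K. (resist k)\<^sup>2 * m k) / S
       + (\<Sum>k. m (k + K)) + suminf m / (S * m 0) + 1 / S + sqrt (suminf m / S))"
proof -
  define M where "M = suminf m"
  have M0: "0 \<le> M" unfolding M_def using sm m_nonneg by (intro suminf_nonneg) auto
  define p where "p n = (\<Sum>k\<in>{n<..N}. resist k * m k) / S" for n
  define f where "f n = (\<Sum>k<n. p k / edge k)" for n
  have p_nonneg: "0 \<le> p n" for n
    unfolding p_def using S resist_nonneg m_nonneg by (intro divide_nonneg_pos sum_nonneg) auto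
  have p_le: "p n \<le> p 0" for n
    unfolding p_def using S resist_nonneg m_nonneg
    by (intro divide_right_mono sum_mono2) auto
  have p_end: "p n = 0" if "N \<le> n" for n
    using that by (simp add: p_def)
  have p_Suc: "p n - p (Suc n) = (if Suc n \<le> N then resist (Suc n) * m (Suc n) / S else 0)" for n
  proof (cases "Suc n \<le> N")
    case True
    then have "{n<..N} = insert (Suc n) {Suc n<..N}" by auto
    then show ?thesis using True by (simp add: p_def add_divide_distrib)
  qed (simp add: p_end)
  \<comment> \<open>Cauchy-Schwarz against the constant 1; the index 0 can be added to the sum
    because \<open>resist 0 = 0\<close>.\<close>
  have p0: "(p 0)\<^sup>2 \<le> M / S"
  proof -
    have "{..N} = insert 0 {0<..N}" by auto
    then have "p 0 = (\<Sum>k\<le>N. resist k * 1 * m k) / S" by (simp add: p_def)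
    then have "(p 0)\<^sup>2 = (\<Sum>k\<le>N. resist k * 1 * m k)\<^sup>2 / S\<^sup>2" by (simp add: power_divide)
    also have "\<dots> \<le> (S * (\<Sum>k\<le>N. 1\<^sup>2 * m k)) / S\<^sup>2"
      unfolding S_def using m_nonneg
      by (intro divide_right_mono weighted_Cauchy_Schwarz_sum) auto
    also have "\<dots> \<le> (S * M) / S\<^sup>2"
      unfolding M_def using S sm m_nonneg
      by (intro divide_right_mono mult_left_mono) (auto intro!: sum_le_suminf)
    also have "\<dots> = M / S" using S by (simp add: power2_eq_square)
    finally show ?thesis .
  qed
  have f0: "f 0 = 0" and f_Suc: "f (Suc n) - f n = p n / edge n" for n
    by (simp_all add: f_def)
  have flow: "edge n * (f (Suc n) - f n) = p n" for n
    using edge_pos[of n] by (simp add: f_Suc)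
  have lap0: "laplacian b m f 0 = - p 0 / m 0"
    using m_pos[of 0] laplacian_0[of f] flow[of 0]
    by (intro laplacian_eqI) (simp add: algebra_simps)
  have lap: "laplacian b m f k = (if k \<le> N then resist k / S else 0)" if "0 < k" for k
  proof -
    from that obtain n where k: "k = Suc n" by (cases k) auto
    have "m k * laplacian b m f k = p n - p (Suc n)"
      unfolding k laplacian_Suc using flow[of n] flow[of "Suc n"] by (simp add: algebra_simps)
    then show ?thesis
      unfolding p_Suc k by (intro laplacian_eqI) (simp add: mult.commute)
  qed
  have f_mono: "f n \<le> f n'" if "n \<le> n'" for n n'
    using that
  proof (rule lift_Suc_mono_le[rotated])
    fix i
    have "0 \<le> f (Suc i) - f i"
      unfolding f_Suc using p_nonneg[of i] edge_pos[of i] by simp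
    then show "f i \<le> f (Suc i)" by simp
  qed
  have f_end: "f n = f N" if "N \<le> n" for n
    using that
  proof (induction n rule: dec_induct)
    case (step n)
    then show ?case using f_Suc[of n] p_end[of n] by simp
  qed simp
  have fN: "f N = 1"
  proof -
    \<comment> \<open>As \<open>f\<close> takes the same value at \<open>N\<close> and
      \<open>Suc N\<close>, the Wronskian is \<open>f N\<close> times the unit flow of
      \<open>resist\<close>.\<close>
    have "wronskian f resist N = f N"
      using edge_pos[of N] f_end[of "Suc N"] by (simp add: wronskian_def resist_Suc algebra_simps)
    moreover have "(\<Sum>k\<le>N. laplacian b m f k * resist k * m k)
        = (\<Sum>k\<le>N. (resist k)\<^sup>2 * m k / S)"
    proof (rule sum.cong)
      fix k assume "k \<in> {..N}"
      then show "laplacian b m f k * resist k * m k = (resist k)\<^sup>2 * m k / S"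
        by (cases "k = 0") (auto simp: lap power2_eq_square)
    qed simp
    moreover have "\<dots> = 1" using S by (simp add: S_def flip: sum_divide_distrib)
    ultimately show ?thesis using wronskian_resist[of f N] f0 by simp
  qed
  have f_end1: "f n = 1" if "N \<le> n" for n using f_end[OF that] fN by simp
  have f_nonneg: "0 \<le> f n" for n using f_mono[of 0 n] f0 by simp
  have f_le1: "f n \<le> 1" for n using f_mono[of n "max n N"] f_end1[of "max n N"] by simp
  have f_le_resist: "f n \<le> p 0 * resist n" for n
    unfolding f_def resist_def sum_distrib_left
    using p_le edge_pos by (intro sum_mono) (simp add: divide_right_mono less_imp_le)
  have f_l2: "f \<in> l2 m"
    unfolding l2_def mem_Collect_eq
  proof (rule summable_comparison_test'[OF sm, where N = 0])
    show "norm ((f n)\<^sup>2 * m n) \<le> m n" for n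
      using f_nonneg[of n] f_le1[of n] m_nonneg[of n]
      by (simp add: mult_left_le_one_le power_le_one)
  qed
  have lap_l2: "laplacian b m f \<in> l2 m"
    using f_end1 by (intro finite_support_l2 laplacian_finite_support)
  \<comment> \<open>Below \<open>K\<close> the bound \<open>f n \<le> p 0 * resist n\<close> gives a
    term of order \<open>1 / S\<close>; from \<open>K\<close> on, \<open>f n \<le> 1\<close> leaves
    a tail of \<open>m\<close>.\<close>
  have norm_f: "(l2_norm m f)\<^sup>2 \<le> M * (\<Sum>k<K. (resist k)\<^sup>2 * m k) / S + (\<Sum>k. m (k + K))"
  proof -
    have sf: "summable (\<lambda>x. (f x)\<^sup>2 * m x)" using f_l2 by (simp add: l2_def)
    have "(l2_norm m f)\<^sup>2 = (\<Sum>k. (f (k + K))\<^sup>2 * m (k + K)) + (\<Sum>k<K. (f k)\<^sup>2 * m k)"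
      unfolding l2_norm_sq[OF m_nonneg f_l2] by (rule suminf_split_initial_segment[OF sf])
    also have "(\<Sum>k. (f (k + K))\<^sup>2 * m (k + K)) \<le> (\<Sum>k. m (k + K))"
    proof (rule suminf_le)
      show "(f (k + K))\<^sup>2 * m (k + K) \<le> m (k + K)" for k
        using f_nonneg f_le1 m_nonneg by (simp add: mult_left_le_one_le power_le_one)
    qed (use sf sm summable_iff_shift[of m K] summable_iff_shift[of "\<lambda>x. (f x)\<^sup>2 * m x" K] in auto)
    also have "(\<Sum>k<K. (f k)\<^sup>2 * m k) \<le> (\<Sum>k<K. (p 0)\<^sup>2 * ((resist k)\<^sup>2 * m k))"
    proof (rule sum_mono)
      fix k
      have "(f k)\<^sup>2 \<le> (p 0 * resist k)\<^sup>2"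
        using f_le_resist f_nonneg by (intro power_mono) auto
      from mult_right_mono[OF this m_nonneg[of k]]
      show "(f k)\<^sup>2 * m k \<le> (p 0)\<^sup>2 * ((resist k)\<^sup>2 * m k)"
        by (simp add: power_mult_distrib mult.assoc)
    qed
    also have "\<dots> = (p 0)\<^sup>2 * (\<Sum>k<K. (resist k)\<^sup>2 * m k)" by (simp add: sum_distrib_left)
    also have "\<dots> \<le> M / S * (\<Sum>k<K. (resist k)\<^sup>2 * m k)"
      using m_nonneg by (intro mult_right_mono p0 sum_nonneg) auto
    finally show ?thesis by simp
  qed
  have norm_lap: "(l2_norm m (laplacian b m f))\<^sup>2 \<le> M / (S * m 0) + 1 / S"
  proof -
    have "(l2_norm m (laplacian b m f))\<^sup>2 = (\<Sum>k\<le>N. (laplacian b m f k)\<^sup>2 * m k)"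
      unfolding l2_norm_sq[OF m_nonneg lap_l2] by (rule suminf_finite) (auto simp: lap)
    \<comment> \<open>The vertex 0 is treated separately: there the Laplacian is
      \<open>- p 0 / m 0\<close>, while \<open>resist 0 = 0\<close>.\<close>
    also have "\<dots> \<le> (\<Sum>k\<le>N. (if k = 0 then (p 0)\<^sup>2 / m 0 else 0) + (resist k)\<^sup>2 * m k / S\<^sup>2)"
    proof (rule sum_mono)
      fix k assume "k \<in> {..N}"
      then show "(laplacian b m f k)\<^sup>2 * m k
          \<le> (if k = 0 then (p 0)\<^sup>2 / m 0 else 0) + (resist k)\<^sup>2 * m k / S\<^sup>2"
        using m_pos[of 0]
        by (cases "k = 0") (auto simp: lap lap0 power_divide power2_eq_square[of "m 0"])
    qed
    also have "\<dots> = (p 0)\<^sup>2 / m 0 + S / S\<^sup>2"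
      by (simp add: sum.distrib S_def flip: sum_divide_distrib)
    also have "S / S\<^sup>2 = 1 / S" using S by (simp add: power2_eq_square)
    also have "(p 0)\<^sup>2 / m 0 \<le> M / S / m 0"
      using p0 m_nonneg by (intro divide_right_mono) auto
    finally show ?thesis by simp
  qed
  have energy: "energy b f \<le> ennreal (sqrt (M / S))"
  proof -
    have "energy b f = (\<Sum>x. ennreal (edge x * (f (Suc x) - f x)\<^sup>2))" by (rule energy_eq)
    also have "\<dots> = (\<Sum>x<N. ennreal (edge x * (f (Suc x) - f x)\<^sup>2))"
      by (rule suminf_finite) (auto simp: f_end1)
    also have "\<dots> = ennreal (\<Sum>x<N. edge x * (f (Suc x) - f x)\<^sup>2)"
      using edge_pos by (intro sum_ennreal) (simp add: less_imp_le)
    \<comment> \<open>Bounding the flow by its maximum \<open>p 0\<close> leaves a telescoping sum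
      equal to \<open>f N - f 0 = 1\<close>.\<close>
    also have "\<dots> \<le> ennreal (\<Sum>x<N. p 0 * (f (Suc x) - f x))"
    proof (intro ennreal_leI sum_mono)
      fix x
      have "edge x * (f (Suc x) - f x)\<^sup>2 = p x * (f (Suc x) - f x)"
        by (simp add: power2_eq_square flip: flow)
      also have "\<dots> \<le> p 0 * (f (Suc x) - f x)"
        using f_mono[of x "Suc x"] by (intro mult_right_mono p_le) auto
      finally show "edge x * (f (Suc x) - f x)\<^sup>2 \<le> p 0 * (f (Suc x) - f x)" .
    qed
    also have "(\<Sum>x<N. p 0 * (f (Suc x) - f x)) = p 0"
      using f0 fN by (simp add: sum_lessThan_telescope flip: sum_distrib_left)
    also have "p 0 \<le> sqrt (M / S)" by (rule real_le_rsqrt[OF p0])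
    finally show ?thesis by (simp add: ennreal_leI)
  qed
  have "f \<in> cap_class b m N"
    using f_l2 lap_l2 energy f_end1
    by (auto simp: cap_class_def H2_def intro: le_less_trans)
  moreover have "H2_norm_sq b m f \<le> ennreal (M * (\<Sum>k<K. (resist k)\<^sup>2 * m k) / S
       + (\<Sum>k. m (k + K)) + M / (S * m 0) + 1 / S + sqrt (M / S))"
  proof -
    let ?A = "M * (\<Sum>k<K. (resist k)\<^sup>2 * m k) / S + (\<Sum>k. m (k + K))"
    let ?B = "M / (S * m 0) + 1 / S"
    have A: "0 \<le> ?A" and B: "0 \<le> ?B"
      using order_trans[OF zero_le_power2 norm_f] order_trans[OF zero_le_power2 norm_lap] .
    have "H2_norm_sq b m f \<le> ennreal ?A + ennreal ?B + ennreal (sqrt (M / S))"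
      unfolding H2_norm_sq_def by (intro add_mono ennreal_leI norm_f norm_lap energy)
    also have "\<dots> = ennreal (?A + ?B + sqrt (M / S))"
    proof -
      have "0 \<le> sqrt (M / S)" using M0 S by simp
      from ennreal_plus[OF add_nonneg_nonneg[OF A B] this] ennreal_plus[OF A B]
      show ?thesis by (simp only:)
    qed
    finally show ?thesis by (simp add: add.assoc)
  qed
  ultimately show ?thesis using that unfolding M_def by blast
qed

text \<open>First \<open>K\<close> is fixed to make the tail of \<open>m\<close> small; then all
  other terms in the bound of \<open>cap_class_competitor\<close> tend to 0 as \<open>N\<close>
  grows, because \<open>S N\<close> diverges.\<close>

lemma Cap22_infinity_eq_0:
  assumes sm: "summable m" and r: "resist \<notin> l2 m"
  shows "Cap22_infinity b m = 0"
proof -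
  define S where "S N = (\<Sum>k\<le>N. (resist k)\<^sup>2 * m k)" for N
  have S_mono: "S n \<le> S n'" if "n \<le> n'" for n n'
    unfolding S_def using that m_nonneg by (intro sum_mono2) auto
  have S_top: "filterlim S at_top sequentially"
    unfolding filterlim_at_top
  proof
    fix Z
    have "\<exists>n. Z \<le> S n"
    proof (rule ccontr)
      assume "\<not> (\<exists>n. Z \<le> S n)"
      then have "S n \<le> Z" for n by (metis linear)
      then have "summable (\<lambda>x. (resist x)\<^sup>2 * m x)"
        using m_nonneg unfolding S_def by (intro bounded_imp_summable[where B = Z]) auto
      then show False using r by (simp add: l2_def)
    qed
    then show "\<forall>\<^sub>F n in sequentially. Z \<le> S n"
      using S_mono by (auto simp: eventually_sequentially intro: order_trans)
  qed
  have le: "Cap22_infinity b m \<le> ennreal \<epsilon>" if "0 < \<epsilon>" for \<epsilon>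
  proof -
    obtain K where K: "norm (\<Sum>k. m (k + K)) < \<epsilon> / 2"
      using suminf_exist_split[OF _ sm, of "\<epsilon> / 2"] \<open>0 < \<epsilon>\<close> by auto
    have inv: "(\<lambda>N. 1 / S N) \<longlonglongrightarrow> 0"
      using tendsto_inverse_0_at_top[OF S_top] by (simp add: inverse_eq_divide)
    let ?R = "\<Sum>k<K. (resist k)\<^sup>2 * m k"
    let ?bd = "\<lambda>N. suminf m * ?R / S N + (\<Sum>k. m (k + K)) + suminf m / (S N * m 0)
      + 1 / S N + sqrt (suminf m / S N)"
    have "(\<lambda>N. suminf m * ?R * (1 / S N) + (\<Sum>k. m (k + K)) + suminf m / m 0 * (1 / S N)
        + 1 / S N + sqrt (suminf m * (1 / S N)))
      \<longlonglongrightarrow> suminf m * ?R * 0 + (\<Sum>k. m (k + K)) + suminf m / m 0 * 0 + 0 + sqrt (suminf m * 0)"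
      by (intro tendsto_intros inv)
    then have "?bd \<longlonglongrightarrow> (\<Sum>k. m (k + K))" by (simp add: mult.commute)
    moreover have "(\<Sum>k. m (k + K)) < \<epsilon>" using K that by (auto simp: abs_if split: if_splits)
    ultimately have "\<forall>\<^sub>F N in sequentially. ?bd N < \<epsilon>" by (rule order_tendstoD(2))
    moreover have "\<forall>\<^sub>F N in sequentially. 0 < S N"
      using S_top by (simp add: filterlim_at_top_dense)
    ultimately have "\<forall>\<^sub>F N in sequentially. ?bd N < \<epsilon> \<and> 0 < S N" by (rule eventually_conj)
    then obtain N where N: "?bd N < \<epsilon>" "0 < S N" by (auto simp: eventually_sequentially)
    obtain f where f: "f \<in> cap_class b m N" "H2_norm_sq b m f \<le> ennreal (?bd N)"
      using cap_class_competitor[OF sm, of N K] N(2) unfolding S_def by blast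
    have "Cap22_infinity b m \<le> H2_norm_sq b m f"
      unfolding Cap22_infinity_eq_INF[OF sm] using f(1) by (intro INF_lower2[of N] INF_lower) auto
    also have "\<dots> \<le> ennreal \<epsilon>" using f(2) N(1) by (meson ennreal_leI less_imp_le order_trans)
    finally show ?thesis .
  qed
  have "Cap22_infinity b m \<le> 0"
  proof (rule ennreal_le_epsilon)
    fix \<epsilon> :: real assume "0 < \<epsilon>"
    from le[OF this] show "Cap22_infinity b m \<le> 0 + ennreal \<epsilon>" by (simp only: add_0)
  qed
  then show ?thesis by simp
qed

text \<open>If \<open>m\<close> is not summable, both sides hold; if it is, the capacity is finite
  and vanishes exactly when \<open>resist\<close> is not in \<open>l2 m\<close>.\<close>

theorem Cap22_infinity_iff:
  "Cap22_infinity b m = 0 \<or> Cap22_infinity b m = \<infinity> \<longleftrightarrow> resist \<notin> l2 m"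
  using Cap22_infinity_eq_top_iff Cap22_infinity_pos Cap22_infinity_eq_0
    summable_m_if_resist_l2 by metis

end

theorem theorem4p19:
  fixes b :: "nat \<Rightarrow> nat \<Rightarrow> real" and m :: "nat \<Rightarrow> real"
  assumes "birth_death_chain b m"
  shows "essentially_self_adjoint m (Lc b m) \<longleftrightarrow>
         Cap22_infinity b m = 0 \<or> Cap22_infinity b m = \<infinity>"
proof -
  interpret birth_death_chain b m by (rule assms)
  show ?thesis
    by (simp only: essentially_self_adjoint_iff Cap22_infinity_iff)
qed

end
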